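(* For $C=0$ or $C=2$, a solvable natural test of cost $C$ does not exist. If $M_C$ is the maximum number of options for a solvable natural test of cost $C$, then $M_C=C-2$ for $C>3$. In addition, $M_1=1$ and $M_3=2$. In addition, for such a test, that is, any solvable natural test of cost $C$ with the maximum number $M_C$ of options, the following holds: (i) for $C=4$ and for $C>5$, such a test has a single valid answer: $2$; (ii) for $C=5$, the valid answers in such a test are $1$ and $2$; (iii) for $C=1$ or $C=3$, such a test has a single valid answer: $1$.
   Context: A natural test is a finite multiset of positive integers (its answers, or options, counted with multiplicity; order is irrelevant); the empty test has cost $0$. The cost $C$ of a test is the sum of all its answers with multiplicity, and the number of options is the number of answers counted with multiplicity. A positive integer $a$ is a valid answer of a natural test if $a$ appears in the test exactly $a$ times. A test is solvable if it has at least one valid answer.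
   Formalization: Clause (i) fails for C=4: the test {1,3} is solvable with the maximum 2 options, but its only valid answer is 1. So for C=4 the claim is proved for every such test other than {1,3}, together with the existence of one whose single valid answer is 2. *)

theory Defs
  imports "HOL-Library.Multiset"
begin

definition natural_test :: "nat multiset \<Rightarrow> bool" where
  "natural_test T \<longleftrightarrow> (\<forall>a\<in>#T. a > 0)"

definition cost :: "nat multiset \<Rightarrow> nat" where
  "cost T = \<Sum>\<^sub># T"

text \<open>Positivity is needed here: \<open>0\<close> occurs exactly \<open>0\<close> times in every natural test.\<close>

definition valid_answers :: "nat multiset \<Rightarrow> nat set" where
  "valid_answers T = {a. a > 0 \<and> count T a = a}"

definition solvable :: "nat multiset \<Rightarrow> bool" where
  "solvable T \<longleftrightarrow> valid_answers T \<noteq> {}"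

definition solvable_tests :: "nat \<Rightarrow> nat multiset set" where
  "solvable_tests C = {T. natural_test T \<and> solvable T \<and> cost T = C}"

text \<open>The number of options is \<^const>\<open>size\<close>. It is at most the cost, so the maximum is over
  a finite set; the set is empty, and the value unspecified, exactly for costs \<open>0\<close> and \<open>2\<close>.\<close>

definition max_size :: "nat \<Rightarrow> nat" where
  "max_size C = Max (size ` solvable_tests C)"

definition maximal_tests :: "nat \<Rightarrow> nat multiset set" where
  "maximal_tests C = {T \<in> solvable_tests C. size T = max_size C}"

text \<open>For cost \<open>4\<close> the maximum number of options is attained both by \<open>{2, 2}\<close>, with valid answer
  \<open>2\<close>, and by \<open>{1, 3}\<close>, whose only valid answer is \<open>1\<close>. The claim that every solvable test of
  cost \<open>4\<close> with the maximum number of options has \<open>2\<close> as its single valid answer therefore needs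
  \<open>{1, 3}\<close> as an exception.\<close>

lemma size_le_2_if_cost_4:
  assumes "T \<in> solvable_tests 4"
  shows "size T \<le> 2"
proof -
  have pos: "\<forall>a\<in>#T. a > 0" and sum: "\<Sum>\<^sub># T = 4"
    using assms by (auto simp: solvable_tests_def natural_test_def cost_def)
  obtain a where a: "a > 0" "count T a = a"
    using assms by (auto simp: solvable_tests_def solvable_def valid_answers_def)
  define S where "S = T - replicate_mset a a"
  have T: "T = replicate_mset a a + S"
    using a by (auto simp: S_def multiset_eq_iff)
  have cS: "count S a = 0"
    using a by (simp add: S_def)
  have sumS: "a * a + \<Sum>\<^sub># S = 4"
    using sum by (simp add: T)
  have "a \<le> 2"
  proof (rule ccontr)
    assume "\<not> a \<le> 2"
    then have "3 * 3 \<le> a * a" by (intro mult_le_mono) auto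
    with sumS show False by simp
  qed
  with a consider "a = 1" | "a = 2" by linarith
  then show ?thesis
  proof cases
    case 1
    have "\<forall>x\<in>#S. 2 \<le> x"
    proof
      fix x assume x: "x \<in># S"
      then have "x > 0" using pos T by simp
      moreover have "x \<noteq> 1" using x cS 1 by (auto simp flip: count_greater_zero_iff)
      ultimately show "2 \<le> x" by linarith
    qed
    moreover have "(\<forall>x\<in>#S. 2 \<le> x) \<Longrightarrow> 2 * size S \<le> \<Sum>\<^sub># S"
      by (induction S) auto
    ultimately show ?thesis using sumS 1 by (simp add: T)
  next
    case 2
    have "\<forall>x\<in>#S. 1 \<le> x" using pos T by (simp add: Suc_le_eq)
    moreover have "(\<forall>x\<in>#S. 1 \<le> x) \<Longrightarrow> size S \<le> \<Sum>\<^sub># S"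
      by (induction S) auto
    moreover have "\<Sum>\<^sub># S = 0" using sumS 2 by simp
    ultimately have "size S \<le> 0" by metis
    then show ?thesis using 2 by (simp add: T)
  qed
qed

lemma valid_answers_1_3: "valid_answers {#1, 3#} = {1}"
  by (auto simp: valid_answers_def split: if_splits)

lemma test_1_3_maximal: "{#1, 3#} \<in> maximal_tests 4"
proof -
  have mem: "{#1, 3#} \<in> solvable_tests 4"
    using valid_answers_1_3
    by (simp add: solvable_tests_def natural_test_def solvable_def cost_def)
  have "max_size 4 = 2"
    unfolding max_size_def
  proof (rule Max_eqI)
    show "finite (size ` solvable_tests 4)"
      by (rule finite_subset[of _ "{..2}"]) (use size_le_2_if_cost_4 in auto)
    show "2 \<in> size ` solvable_tests 4"
      using imageI[OF mem, of size] by (simp add: numeral_2_eq_2)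
  qed (use size_le_2_if_cost_4 in auto)
  with mem show ?thesis by (simp add: maximal_tests_def)
qed

end

theory Submission
  imports Defs
begin

text \<open>
  Measure a natural test by its excess: the sum of \<open>a - 1\<close> over its answers \<open>a\<close>, which is its cost
  minus its number of options. For a given cost, having the most options means having the least
  excess. The excess is additive, and a valid answer \<open>a\<close> alone accounts for
  \<open>a * (a - 1)\<close> of it. Hence excess at most \<open>2\<close> forces a valid answer \<open>a \<le> 2\<close>.

  A valid answer \<open>2\<close> exhausts the excess \<open>2\<close>, so all other answers are \<open>1\<close>. If \<open>1\<close> is valid, the
  other answers are all at least \<open>2\<close>, so each costs at least \<open>1\<close> of excess and there are at most two
  of them. This leaves \<open>{1}\<close>, \<open>{1, 2}\<close>, \<open>{1, 3}\<close> and the family of tests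
  \<open>{2, 2, 1, ..., 1}\<close> (lemma \<open>solvable_excess_le_2\<close>).

  The theorem is read off from this list. The only excesses below \<open>2\<close> occur for \<open>{1}\<close> and
  \<open>{1, 2}\<close>, of costs \<open>1\<close> and \<open>3\<close>; from cost \<open>4\<close> on, the family
  provides a test of excess exactly \<open>2\<close>, which is therefore minimal. At cost at most \<open>3\<close>
  every solvable test has at least one option, hence excess at most \<open>2\<close>, and again is on the list.
  Cost \<open>5\<close> is special because \<open>{1, 2, 2}\<close> is the one member of the family in which \<open>1\<close> is valid too.
\<close>

definition excess :: "nat multiset \<Rightarrow> nat" where
  "excess T = (\<Sum>x\<in>#T. x - 1)"

lemma excess_simps [simp]:
  "excess {#} = 0"
  "excess (add_mset x T) = x - 1 + excess T"
  "excess (S + T) = excess S + excess T"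
  "excess (replicate_mset n x) = n * (x - 1)"
  by (simp_all add: excess_def)

lemma cost_eq_size_plus_excess:
  assumes "natural_test T"
  shows "cost T = size T + excess T"
  using assms by (induction T) (auto simp: natural_test_def cost_def)

lemma excess_0_imp_all_ones:
  assumes "natural_test T" "excess T = 0"
  shows "T = replicate_mset (size T) 1"
proof -
  have "set_mset T \<subseteq> {1}"
    using assms by (fastforce simp: natural_test_def excess_def)
  then show ?thesis by (rule set_mset_subset_singletonD)
qed

lemma excess_le_2_without_ones:
  assumes ge2: "\<forall>x\<in>#S. 2 \<le> x" and ex: "excess S \<le> 2"
  shows "S \<in> {{#}, {#2#}, {#3#}, {#2, 2#}}"
proof (cases S)
  case (add x S')
  note S = this
  show ?thesis
  proof (cases S')
    case empty
    have "x = 2 \<or> x = 3" using ge2 ex by (auto simp: S empty)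
    then show ?thesis by (auto simp: S empty)
  next
    case (add y S'')
    have xy: "x = 2" "y = 2" "excess S'' = 0" using ge2 ex by (auto simp: S add)
    have "S'' = {#}"
    proof (cases S'')
      case (add z R)
      then show ?thesis using ge2 xy(3) S \<open>S' = _\<close> by auto
    qed
    then show ?thesis using xy by (simp add: S add)
  qed
qed simp

lemma solvable_excess_le_2:
  assumes nat: "natural_test T" and "solvable T" and ex: "excess T \<le> 2"
  shows "T \<in> {{#1#}, {#1, 2#}, {#1, 3#}} \<or> (\<exists>n. T = {#2, 2#} + replicate_mset n 1)"
proof -
  obtain a where a: "a > 0" "count T a = a"
    using assms by (auto simp: solvable_def valid_answers_def)
  define S where "S = T - replicate_mset a a"
  have T: "T = replicate_mset a a + S"
    using a by (auto simp: S_def multiset_eq_iff)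
  have "a \<notin># S"
    using a by (simp add: S_def not_in_iff)
  have natS: "natural_test S"
    using nat by (auto simp: T natural_test_def)
  have exS: "a * (a - 1) + excess S \<le> 2"
    using ex by (simp add: T)
  have "a \<le> 2"
  proof (rule ccontr)
    assume "\<not> a \<le> 2"
    then have "3 * 2 \<le> a * (a - 1)" by (intro mult_le_mono) auto
    with exS show False by simp
  qed
  with a consider "a = 1" | "a = 2" by linarith
  then show ?thesis
  proof cases
    case 1
    have "2 \<le> x" if "x \<in># S" for x
    proof -
      have "x > 0" "x \<noteq> 1" using that natS \<open>a \<notin># S\<close> 1 by (auto simp: natural_test_def)
      then show ?thesis by linarith
    qed
    then have "S \<in> {{#}, {#2#}, {#3#}, {#2, 2#}}"
      using exS 1 by (intro excess_le_2_without_ones) auto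
    \<comment> \<open>The test \<open>{1, 2, 2}\<close> belongs to the family, with a single \<open>1\<close>.\<close>
    moreover have "\<exists>n. {#1, 2, 2#} = {#2, 2#} + replicate_mset n (1::nat)"
      by (rule exI[of _ 1]) simp
    ultimately show ?thesis by (auto simp: T 1)
  next
    case 2
    then have "S = replicate_mset (size S) 1"
      using exS natS by (intro excess_0_imp_all_ones) auto
    then show ?thesis using 2 by (auto simp: T numeral_2_eq_2)
  qed
qed

lemma valid_answers_twos_and_ones:
  "valid_answers ({#2, 2#} + replicate_mset n 1) = (if n = 1 then {1, 2} else {2})"
  by (auto simp: valid_answers_def split: if_splits)

lemma twos_and_ones_solvable:
  "{#2, 2#} + replicate_mset n 1 \<in> solvable_tests (n + 4)"
proof -
  have "solvable ({#2, 2#} + replicate_mset n 1)"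
    by (simp only: solvable_def valid_answers_twos_and_ones split: if_splits) simp
  then show ?thesis
    by (auto simp: solvable_tests_def natural_test_def cost_def)
qed

lemma valid_answers_1: "valid_answers {#1#} = {1}"
  by (auto simp: valid_answers_def split: if_splits)

lemma valid_answers_1_2: "valid_answers {#1, 2#} = {1}"
  by (auto simp: valid_answers_def split: if_splits)

text \<open>The bound on the excess is phrased through cost and size, since the maximum is taken over sizes
  at a fixed cost; the cost then selects the entry of the classification.\<close>

lemma solvable_tests_excess_le_2_cases:
  assumes "T \<in> solvable_tests C" "C \<le> size T + 2"
  obtains (one) "T = {#1#}" "C = 1"
    | (one_two) "T = {#1, 2#}" "C = 3"
    | (one_three) "T = {#1, 3#}" "C = 4"
    | (twos) n where "T = {#2, 2#} + replicate_mset n 1" "C = n + 4"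
proof -
  have T: "natural_test T" "solvable T" "cost T = C"
    using assms(1) by (auto simp: solvable_tests_def)
  have "excess T \<le> 2"
    using cost_eq_size_plus_excess[OF T(1)] T(3) assms(2) by simp
  from solvable_excess_le_2[OF T(1,2) this]
  show ?thesis
    using T(3) one one_two one_three twos by (auto simp: cost_def)
qed

text \<open>A solvable test has at least one option, so a cost of at most \<open>3\<close> bounds its excess by \<open>2\<close>.\<close>

lemma solvable_tests_cost_le_3:
  assumes "T \<in> solvable_tests C" "C \<le> 3"
  shows "T = {#1#} \<and> C = 1 \<or> T = {#1, 2#} \<and> C = 3"
proof -
  have "T \<noteq> {#}"
    using assms by (auto simp: solvable_tests_def solvable_def valid_answers_def)
  then have "size T > 0" by (simp add: nonempty_has_size)
  with assms(2) have "C \<le> size T + 2" by linarith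
  with assms(1) show ?thesis
    by (cases rule: solvable_tests_excess_le_2_cases) (use assms(2) in auto)
qed

lemma solvable_tests_1: "solvable_tests 1 = {{#1#}}"
proof -
  have "{#1#} \<in> solvable_tests 1"
    using valid_answers_1 by (simp add: solvable_tests_def natural_test_def cost_def solvable_def)
  moreover have "T = {#1#}" if "T \<in> solvable_tests 1" for T
    using solvable_tests_cost_le_3[OF that] by simp
  ultimately show ?thesis by blast
qed

lemma solvable_tests_3: "solvable_tests 3 = {{#1, 2#}}"
proof -
  have "{#1, 2#} \<in> solvable_tests 3"
    using valid_answers_1_2 by (simp add: solvable_tests_def natural_test_def cost_def solvable_def)
  moreover have "T = {#1, 2#}" if "T \<in> solvable_tests 3" for T
    using solvable_tests_cost_le_3[OF that] by simp
  ultimately show ?thesis by blast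
qed

lemma max_size_ge_4:
  assumes "C > 3"
  shows "max_size C = C - 2"
  unfolding max_size_def
proof (rule Max_eqI)
  have le: "size T \<le> C - 2" if "T \<in> solvable_tests C" for T
  proof (rule ccontr)
    assume "\<not> size T \<le> C - 2"
    then have *: "C \<le> size T + 2" by linarith
    from that * show False
      by (cases rule: solvable_tests_excess_le_2_cases)
        (use assms \<open>\<not> size T \<le> C - 2\<close> in auto)
  qed
  then show "finite (size ` solvable_tests C)"
    by (intro finite_subset[OF _ finite_atMost[of "C - 2"]] image_subsetI) simp
  show "y \<le> C - 2" if "y \<in> size ` solvable_tests C" for y
    using that le by auto
  have "{#2, 2#} + replicate_mset (C - 4) 1 \<in> solvable_tests C"
    using twos_and_ones_solvable[of "C - 4"] assms by simp
  moreover have "C - 2 = size ({#2, 2#} + replicate_mset (C - 4) (1::nat))"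
    using assms by simp
  ultimately show "C - 2 \<in> size ` solvable_tests C"
    by (rule rev_image_eqI)
qed

lemma maximal_tests_ge_4:
  assumes "C > 3" "T \<in> maximal_tests C"
  shows "T = {#1, 3#} \<and> C = 4 \<or> T = {#2, 2#} + replicate_mset (C - 4) 1"
proof -
  have T: "T \<in> solvable_tests C" "C \<le> size T + 2"
    using assms by (auto simp: maximal_tests_def max_size_ge_4)
  then show ?thesis
    by (cases rule: solvable_tests_excess_le_2_cases) (use assms in auto)
qed

theorem theorem8:
  "solvable_tests 0 = {} \<and> solvable_tests 2 = {} \<and>
   (\<forall>C>3. max_size C = C - 2) \<and> max_size 1 = 1 \<and> max_size 3 = 2 \<and>
   (\<forall>T\<in>maximal_tests 4. T \<noteq> {#1, 3#} \<longrightarrow> valid_answers T = {2}) \<and>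
   (\<exists>T\<in>maximal_tests 4. valid_answers T = {2}) \<and>
   (\<forall>C>5. \<forall>T\<in>maximal_tests C. valid_answers T = {2}) \<and>
   (\<forall>T\<in>maximal_tests 5. valid_answers T = {1, 2}) \<and>
   (\<forall>T\<in>maximal_tests 1. valid_answers T = {1}) \<and>
   (\<forall>T\<in>maximal_tests 3. valid_answers T = {1})"
proof (intro conjI allI impI ballI)
  show "solvable_tests 0 = {}" using solvable_tests_cost_le_3[of _ 0] by auto
  show "solvable_tests 2 = {}" using solvable_tests_cost_le_3[of _ 2] by auto
  show "max_size C = C - 2" if "C > 3" for C using that by (rule max_size_ge_4)
  show "max_size 1 = 1" unfolding max_size_def solvable_tests_1 by simp
  show "max_size 3 = 2" unfolding max_size_def solvable_tests_3 by simp
  show "valid_answers T = {2}" if "T \<in> maximal_tests 4" "T \<noteq> {#1, 3#}" for T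
    using maximal_tests_ge_4[OF _ that(1)] that(2) valid_answers_twos_and_ones[of 0] by auto
  show "\<exists>T\<in>maximal_tests 4. valid_answers T = {2}"
    using twos_and_ones_solvable[of 0] valid_answers_twos_and_ones[of 0]
    by (intro bexI[of _ "{#2, 2#}"]) (auto simp: maximal_tests_def max_size_ge_4)
  show "valid_answers T = {2}" if "C > 5" "T \<in> maximal_tests C" for C T
    using maximal_tests_ge_4[OF _ that(2)] that(1) valid_answers_twos_and_ones[of "C - 4"] by auto
  show "valid_answers T = {1, 2}" if "T \<in> maximal_tests 5" for T
    using maximal_tests_ge_4[OF _ that] valid_answers_twos_and_ones[of 1] by auto
  show "valid_answers T = {1}" if "T \<in> maximal_tests 1" for T
    using that valid_answers_1 unfolding maximal_tests_def solvable_tests_1 by auto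
  show "valid_answers T = {1}" if "T \<in> maximal_tests 3" for T
    using that valid_answers_1_2 unfolding maximal_tests_def solvable_tests_3 by auto
qed

end
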